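(* Let $n\ge 2$, let $\boldsymbol{\tau}_n=23\cdots n1$, and let $\triangle_n=\operatorname{conv}(\mathcal{S}^{\boldsymbol{\tau}_n})\subset\mathbb{R}^n$. Then the simplex $\triangle_n$ is hollow. Specifically, every point of $\triangle_n\cap\mathbb{Z}^n$ that is not a vertex of $\triangle_n$ lies on the facet $\operatorname{conv}(\mathcal{S}^{\boldsymbol{\tau}_n}\setminus\{\mathbf{e}\})$, where $\mathbf{e}=(1,2,\dots,n)$.
   Context: Stack-sorting: for a finite sequence $\boldsymbol{\pi}=\pi_1\pi_2\cdots\pi_n$ of distinct elements of a totally ordered set, the output $s(\boldsymbol{\pi})$ is obtained as follows. Start with an empty stack (last-in, first-out) and an empty output. For $i=1,\dots,n$ in order: while the stack is nonempty and $\pi_i$ is greater than the top element of the stack, pop the top element and append it to the end of the output; then push $\pi_i$ onto the stack. After all entries have been pushed, pop all remaining elements from top to bottom, appending each to the output. Write $s^0(\boldsymbol{\pi})=\boldsymbol{\pi}$ and $s^{i}(\boldsymbol{\pi})=s(s^{i-1}(\boldsymbol{\pi}))$. For a permutation $\boldsymbol{\pi}$ of $\{1,\dots,n\}$, iterating $s$ eventually reaches the identity $12\cdots n$ (fixed by $s$), and $\mathcal{S}^{\boldsymbol{\pi}}:=\{s^0(\boldsymbol{\pi}),s^1(\boldsymbol{\pi}),s^2(\boldsymbol{\pi}),\dots\}$ is the finite set of all iterates until the identity is reached. Permutations $\pi_1\cdots\pi_n$ in one-line notation are identified with points $(\pi_1,\dots,\pi_n)\in\mathbb{R}^n$; in particular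 $\boldsymbol{\tau}_n=(2,3,\dots,n,1)$. The polytope $\triangle_n$ is an $(n-1)$-dimensional simplex with vertex set $\mathcal{S}^{\boldsymbol{\tau}_n}$. A polytope is hollow if all of its integer points lie on its (relative) boundary, equivalently it has no integer points in its relative interior. *)

theory Defs
  imports "HOL-Analysis.Analysis"
begin

text \<open>The arguments are the remaining input, the stack (top first) and the output so far.\<close>

fun stack_run :: "'a::linorder list \<Rightarrow> 'a list \<Rightarrow> 'a list \<Rightarrow> 'a list" where
  "stack_run [] st out = out @ st"
| "stack_run (x # xs) [] out = stack_run xs [x] out"
| "stack_run (x # xs) (t # st) out =
     (if x > t then stack_run (x # xs) st (out @ [t]) else stack_run xs (x # t # st) out)"

definition stack_sort :: "'a::linorder list \<Rightarrow> 'a list" where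
  "stack_sort xs = stack_run xs [] []"

text \<open>For a permutation of \<open>{1..n}\<close> this is the finite set of all iterates up to the identity,
  because the identity is reached and is fixed by \<^const>\<open>stack_sort\<close>.\<close>

definition sort_iterates :: "'a::linorder list \<Rightarrow> 'a list set" where
  "sort_iterates xs = {(stack_sort ^^ i) xs | i. True}"

definition tau :: "nat \<Rightarrow> nat list" where
  "tau n = [2..<Suc n] @ [1]"

definition ident :: "nat \<Rightarrow> nat list" where
  "ident n = [1..<Suc n]"

text \<open>One-line notation as a point of Euclidean space. The linear order on the index type numbers
  the coordinates: index \<open>i\<close> is the coordinate number \<open>card {j. j < i}\<close>, counted from 0.
  Only lists of length \<open>CARD('n)\<close> give meaningful points.\<close>

definition perm_point :: "nat list \<Rightarrow> real ^ ('n::{finite,linorder})" where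
  "perm_point xs = (\<chi> i. real (xs ! card {j. j < i}))"

definition integer_points :: "(real ^ 'n) set" where
  "integer_points = {x. \<forall>i. x $ i \<in> \<int>}"

definition hollow :: "(real ^ 'n) set \<Rightarrow> bool" where
  "hollow P \<longleftrightarrow> P \<inter> integer_points \<subseteq> rel_frontier P"

end

theory Submission
  imports Defs
begin

text \<open>
  Sorting \<open>2 3 \<dots> n 1\<close> moves the entry 1 one place to the left at each pass until it comes
  first, so the iterates are \<open>2 3 \<dots> (m+1) 1 (m+2) \<dots> n\<close> for \<open>m < n\<close>, where \<open>m\<close> is the position of 1 counted from 0; the case
  \<open>m = 0\<close> is the identity \<open>e\<close> (lemma \<open>sort_iterates_tau\<close>). As a vector, the \<open>m\<close>-th iterate minus
  \<open>e\<close> is \<open>(1, \<dots>, 1, -m, 0, \<dots>, 0)\<close> with \<open>m\<close> ones. These differences form a triangular system, so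
  the \<open>n\<close> iterates are affinely independent (lemma \<open>affine_independent_tau_vertices\<close>) and their
  hull is an \<open>(n - 1)\<close>-simplex with \<open>conv (V - {e})\<close> as a facet.

  Hollowness is visible in the first coordinate alone: it is 1 at \<open>e\<close> and 2 at every other vertex.
  A convex combination that gives \<open>e\<close> the weight \<open>c\<close> has first coordinate \<open>2 - c\<close>, and this is an
  integer only if \<open>c\<close> is 0 or 1. Hence an integer point of the simplex is \<open>e\<close> itself or lies on the
  facet opposite to \<open>e\<close>; in both cases it lies on a proper face.
\<close>

section \<open>The iterates of the stack-sorting map\<close>

definition tau_iterate :: "nat \<Rightarrow> nat \<Rightarrow> nat list" where
  "tau_iterate n m = [2..<m+2] @ 1 # [m+2..<Suc n]"

text \<open>Along an increasing run, each new entry pops its predecessor, so the stack keeps holding the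
  current maximum alone.\<close>

lemma stack_run_increasing:
  "a \<le> b \<Longrightarrow> stack_run ([Suc a..<Suc b] @ ys) [a] out = stack_run ys [b] (out @ [a..<b])"
proof (induction "b - a" arbitrary: a out)
  case 0
  then show ?case by simp
next
  case (Suc k)
  then have "a < b" by simp
  then have "[Suc a..<Suc b] = Suc a # [Suc (Suc a)..<Suc b]" and "[a..<b] = a # [Suc a..<b]"
    by (simp_all add: upt_conv_Cons del: upt_Suc)
  moreover have "stack_run ([Suc (Suc a)..<Suc b] @ ys) [Suc a] (out @ [a])
      = stack_run ys [b] ((out @ [a]) @ [Suc a..<b])"
    using Suc(2) \<open>a < b\<close> by (intro Suc(1)) auto
  ultimately show ?case by simp
qed

lemma stack_run_increasing_to_end:
  assumes "a \<le> b"
  shows "stack_run [Suc a..<Suc b] [a] out = out @ [a..<Suc b]"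
  using stack_run_increasing[OF assms, of "[]"] assms by simp

lemma stack_sort_tau_iterate_Suc:
  assumes "Suc m < n"
  shows "stack_sort (tau_iterate n (Suc m)) = tau_iterate n m"
proof -
  have "stack_sort (tau_iterate n (Suc m))
      = stack_run ([Suc 2..<Suc (m+2)] @ 1 # [m+3..<Suc n]) [2] []"
    by (simp add: stack_sort_def tau_iterate_def upt_conv_Cons numeral_eq_Suc del: upt_Suc)
  also have "\<dots> = stack_run (1 # [m+3..<Suc n]) [m+2] [2..<m+2]"
    using stack_run_increasing[of 2 "m+2" "1 # [m+3..<Suc n]" "[]"] by simp
  also have "\<dots> = stack_run [m+3..<Suc n] [1, m+2] [2..<m+2]"
    by simp
  also have "\<dots> = tau_iterate n m"
  proof (cases "m + 2 = n")
    case True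
    then have "[m+3..<Suc n] = []" "[m+2..<Suc n] = [m+2]" by auto
    then show ?thesis unfolding tau_iterate_def by simp
  next
    case False
    with assms have le: "m + 3 \<le> n" by simp
    then have "[m+3..<Suc n] = (m+3) # [Suc (m+3)..<Suc n]"
      and "[m+2..<Suc n] = (m+2) # [m+3..<Suc n]"
      by (simp_all add: upt_conv_Cons numeral_eq_Suc del: upt_Suc)
    then show ?thesis
      using stack_run_increasing_to_end[OF le, of "[2..<m+2] @ [1, m+2]"]
      by (simp add: tau_iterate_def del: upt_Suc)
  qed
  finally show ?thesis .
qed

lemma tau_iterate_0: "n \<ge> 1 \<Longrightarrow> tau_iterate n 0 = ident n"
  by (simp add: tau_iterate_def ident_def upt_conv_Cons numeral_eq_Suc del: upt_Suc)

lemma stack_sort_ident: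
  assumes "n \<ge> 1"
  shows "stack_sort (ident n) = ident n"
  using stack_run_increasing_to_end[of 1 n "[]"] assms
  by (simp add: stack_sort_def ident_def upt_conv_Cons del: upt_Suc)

text \<open>Truncated subtraction on the naturals makes the formula cover the constant tail of the
  sequence as well.\<close>

lemma stack_sort_funpow_tau:
  assumes "n \<ge> 1"
  shows "(stack_sort ^^ i) (tau n) = tau_iterate n (n - 1 - i)"
proof (induction i)
  case 0
  with assms show ?case by (simp add: tau_def tau_iterate_def)
next
  case (Suc i)
  show ?case
  proof (cases "i < n - 1")
    case True
    then have "n - 1 - i = Suc (n - 1 - Suc i)" by simp
    with Suc stack_sort_tau_iterate_Suc[of "n - 1 - Suc i" n] assms show ?thesis by simp
  next
    case False
    with Suc assms show ?thesis by (simp add: tau_iterate_0 stack_sort_ident)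
  qed
qed

lemma sort_iterates_tau:
  assumes "n \<ge> 1"
  shows "sort_iterates (tau n) = tau_iterate n ` {..<n}"
proof -
  have "(\<lambda>i. n - 1 - i) ` UNIV = {..<n}"
  proof
    show "{..<n} \<subseteq> range (\<lambda>i. n - 1 - i)"
    proof
      fix m assume "m \<in> {..<n}"
      then have "m = n - 1 - (n - 1 - m)" by auto
      then show "m \<in> range (\<lambda>i. n - 1 - i)" by blast
    qed
  qed (use assms in auto)
  then have "tau_iterate n ` {..<n} = range (\<lambda>i. tau_iterate n (n - 1 - i))"
    by (metis image_image)
  then show ?thesis
    by (auto simp: sort_iterates_def stack_sort_funpow_tau[OF assms])
qed

section \<open>The iterates as points\<close>

definition index_rank :: "'n::{finite,linorder} \<Rightarrow> nat" where
  "index_rank i = card {j. j < i}"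

lemma index_rank_less: "index_rank (i::'n::{finite,linorder}) < CARD('n)"
  unfolding index_rank_def by (rule psubset_card_mono) auto

lemma strict_mono_index_rank: "strict_mono (index_rank :: 'n::{finite,linorder} \<Rightarrow> nat)"
  unfolding index_rank_def by (rule strict_monoI, rule psubset_card_mono) auto

lemma index_rank_surj:
  assumes "p < CARD('n::{finite,linorder})"
  obtains i :: "'n::{finite,linorder}" where "index_rank i = p"
proof -
  have "card (range (index_rank :: 'n \<Rightarrow> nat)) = CARD('n)"
    using strict_mono_index_rank by (intro card_image) (rule strict_mono_imp_inj_on)
  then have "range (index_rank :: 'n \<Rightarrow> nat) = {..<CARD('n)}"
    using index_rank_less by (intro card_subset_eq) auto
  with assms that show ?thesis by (metis imageE lessThan_iff)
qed

definition tau_vertex :: "nat \<Rightarrow> real ^ ('n::{finite,linorder})" where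
  "tau_vertex m = perm_point (tau_iterate CARD('n) m)"

text \<open>The summand \<open>p + 1\<close> is the coordinate of the identity, so the other two are the entries
  of the difference vector \<open>(1, \<dots>, 1, -m, 0, \<dots>, 0)\<close>.\<close>

lemma tau_vertex_nth:
  fixes i :: "'n::{finite,linorder}"
  defines "p \<equiv> index_rank i"
  assumes "m < CARD('n)"
  shows "tau_vertex m $ i = real p + 1 + of_bool (p < m) - of_bool (p = m) * real p"
proof -
  have "p < CARD('n)" unfolding p_def by (rule index_rank_less)
  moreover have "tau_vertex m $ i = real (tau_iterate CARD('n) m ! p)"
    by (simp add: tau_vertex_def perm_point_def index_rank_def p_def)
  ultimately show ?thesis
    using assms(2)
    by (auto simp: tau_iterate_def nth_append nth_Cons' simp del: upt_Suc)
qed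

text \<open>The triangular shape of the difference vectors, in coordinates: the coefficients below
  position \<open>p\<close> enter the \<open>p\<close>-th coordinate only through the total weight.\<close>

lemma tau_vertex_combination_nth:
  fixes i :: "'n::{finite,linorder}" and u :: "nat \<Rightarrow> real"
  defines "p \<equiv> index_rank i"
  shows "(\<Sum>m<CARD('n). u m *\<^sub>R tau_vertex m) $ i
    = (real p + 1) * (\<Sum>m<CARD('n). u m) + (\<Sum>m\<in>{p<..<CARD('n)}. u m) - real p * u p"
proof -
  let ?N = "CARD('n)"
  have p: "p < ?N" unfolding p_def by (rule index_rank_less)
  have "(\<Sum>m<?N. u m *\<^sub>R tau_vertex m) $ i
      = (\<Sum>m<?N. (real p + 1) * u m + of_bool (p < m) * u m - of_bool (p = m) * (real p * u m))"
    by (auto simp: tau_vertex_nth p_def algebra_simps intro!: sum.cong)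
  also have "\<dots> = (real p + 1) * (\<Sum>m<?N. u m) + (\<Sum>m<?N. of_bool (p < m) * u m)
      - (\<Sum>m<?N. of_bool (p = m) * (real p * u m))"
    by (simp add: sum.distrib sum_subtractf sum_distrib_left)
  also have "(\<Sum>m<?N. of_bool (p < m) * u m) = (\<Sum>m\<in>{p<..<?N}. u m)"
    by (rule sum.mono_neutral_cong_right) auto
  also have "(\<Sum>m<?N. of_bool (p = m) * (real p * u m)) = (\<Sum>m\<in>{p}. real p * u m)"
    using p by (intro sum.mono_neutral_cong_right) auto
  finally show ?thesis by simp
qed

text \<open>The last nonzero coefficient \<open>u k\<close> of a relation would have to satisfy \<open>k * u k = 0\<close>, by the
  coordinate of rank \<open>k\<close>; so only \<open>u 0\<close> could be nonzero, and the total weight excludes that.\<close>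

lemma tau_vertex_relation_trivial:
  fixes u :: "nat \<Rightarrow> real"
  assumes sum0: "(\<Sum>m<CARD('n). u m) = 0"
    and comb0: "(\<Sum>m<CARD('n). u m *\<^sub>R (tau_vertex m :: real ^ 'n::{finite,linorder})) = 0"
    and "m < CARD('n)"
  shows "u m = 0"
proof (rule ccontr)
  assume "u m \<noteq> 0"
  let ?S = "{m. m < CARD('n) \<and> u m \<noteq> 0}"
  define k where "k = Max ?S"
  have "m \<in> ?S" using assms(3) \<open>u m \<noteq> 0\<close> by simp
  then have "k \<in> ?S" unfolding k_def by (intro Max_in) auto
  then have k: "k < CARD('n)" "u k \<noteq> 0" by auto
  have above: "u l = 0" if "k < l" "l < CARD('n)" for l
  proof (rule ccontr)
    assume "u l \<noteq> 0"
    with that have "l \<le> k" unfolding k_def by (intro Max_ge) auto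
    with that show False by simp
  qed
  obtain i :: 'n where "index_rank i = k" using index_rank_surj k(1) by blast
  then have "(\<Sum>m\<in>{k<..<CARD('n)}. u m) - real k * u k = 0"
    using tau_vertex_combination_nth[of u i] comb0 sum0 by simp
  with above k(2) have "k = 0" by simp
  with above k(1) have "(\<Sum>m<CARD('n). u m) = (\<Sum>m\<in>{0}. u m)"
    by (intro sum.mono_neutral_right) auto
  with sum0 \<open>k = 0\<close> k(2) show False by simp
qed

lemma inj_on_tau_vertex:
  fixes w :: "nat \<Rightarrow> real ^ 'n::{finite,linorder}"
  defines "w \<equiv> tau_vertex"
  shows "inj_on w {..<CARD('n)}"
proof (rule inj_onI)
  fix k l
  assume k: "k \<in> {..<CARD('n)}" and l: "l \<in> {..<CARD('n)}" and eq: "w k = w l"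
  let ?u = "\<lambda>m. of_bool (m = k) - of_bool (m = l) :: real"
  have "(\<Sum>m<CARD('n). ?u m) = 0"
    using k l by (simp add: sum_subtractf of_bool_def)
  moreover have "?u m *\<^sub>R w m = (if m = k then w m else 0) - (if m = l then w m else 0)" for m
    by simp
  then have "(\<Sum>m<CARD('n). ?u m *\<^sub>R w m) = w k - w l"
    using k l by (simp only: sum_subtractf) simp
  ultimately have "?u k = 0"
    using k eq tau_vertex_relation_trivial[where 'n = 'n, of ?u k, folded w_def] by simp
  then show "k = l" by (simp split: if_splits)
qed

lemma affine_independent_tau_vertices:
  fixes w :: "nat \<Rightarrow> real ^ 'n::{finite,linorder}"
  defines "w \<equiv> tau_vertex"
  shows "\<not> affine_dependent (w ` {..<CARD('n)})"
proof
  let ?W = "w ` {..<CARD('n)}"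
  assume "affine_dependent ?W"
  then obtain U where U: "sum U ?W = 0" "\<exists>v\<in>?W. U v \<noteq> 0" "(\<Sum>v\<in>?W. U v *\<^sub>R v) = 0"
    by (auto simp: affine_dependent_explicit_finite)
  from U(2) obtain m where "m < CARD('n)" "U (w m) \<noteq> 0" by auto
  moreover have "U (w m) = 0"
    using U(1,3) \<open>m < CARD('n)\<close> tau_vertex_relation_trivial[where 'n = 'n, of "\<lambda>m. U (w m)" m]
    by (simp add: sum.reindex[OF inj_on_tau_vertex] w_def)
  ultimately show False by simp
qed

section \<open>Integer points of the simplex\<close>

text \<open>The first coordinate is 1 at \<open>tau_vertex 0\<close> and 2 at all other vertices, so an integer value
  forces the weight of \<open>tau_vertex 0\<close> to be 0 or 1.\<close>

lemma integer_point_in_tau_hull: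
  fixes x :: "real ^ 'n::{finite,linorder}"
  defines "W \<equiv> tau_vertex ` {..<CARD('n)}"
  assumes "x \<in> convex hull W" and "x \<in> integer_points"
  shows "x = tau_vertex 0 \<or> x \<in> convex hull (W - {tau_vertex 0})"
proof -
  have pos: "0 < CARD('n)" by simp
  then have inW: "tau_vertex 0 \<in> W" unfolding W_def by auto
  have fin: "finite W" unfolding W_def by simp
  obtain c where c: "\<And>v. v \<in> W \<Longrightarrow> 0 \<le> c v" "sum c W = 1" "(\<Sum>v\<in>W. c v *\<^sub>R v) = x"
    using assms(2) by (auto simp: convex_hull_finite[OF fin])
  let ?c0 = "c (tau_vertex 0)"
  let ?R = "W - {tau_vertex 0}"
  have rest: "sum c ?R = 1 - ?c0"
    using c(2) by (simp add: sum_diff1 fin inW)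
  obtain i :: 'n where i: "index_rank i = 0" using index_rank_surj[OF pos] by blast
  have comb: "x = (\<Sum>m<CARD('n). c (tau_vertex m) *\<^sub>R tau_vertex m)"
    and total: "(\<Sum>m<CARD('n). c (tau_vertex m)) = 1"
    using c(2,3) unfolding W_def by (simp_all add: sum.reindex[OF inj_on_tau_vertex])
  have "{..<CARD('n)} = insert 0 {0<..<CARD('n)}" by auto
  with total have "(\<Sum>m\<in>{0<..<CARD('n)}. c (tau_vertex m)) = 1 - ?c0" by simp
  then have "x $ i = 2 - ?c0"
    unfolding comb tau_vertex_combination_nth total i by simp
  moreover have "x $ i \<in> \<int>" using assms(3) by (simp add: integer_points_def)
  ultimately obtain z :: int where z: "2 - ?c0 = of_int z" by (metis Ints_cases)
  have "0 \<le> sum c ?R" using c(1) by (intro sum_nonneg) auto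
  with rest c(1)[OF inW] z have "1 \<le> z" "z \<le> 2" by linarith+
  with z have "?c0 = 1 \<or> ?c0 = 0" by (cases "z = 1") auto
  then show ?thesis
  proof
    assume "?c0 = 1"
    with rest have "\<forall>v\<in>?R. c v = 0"
      using sum_nonneg_eq_0_iff[of ?R c] fin c(1) by auto
    then have "(\<Sum>v\<in>W. c v *\<^sub>R v) = (\<Sum>v\<in>{tau_vertex 0}. c v *\<^sub>R v)"
      using fin inW by (intro sum.mono_neutral_right) auto
    with c(3) \<open>?c0 = 1\<close> show ?thesis by simp
  next
    assume "?c0 = 0"
    then have "(\<Sum>v\<in>?R. c v *\<^sub>R v) = x"
      using c(3) by (simp add: sum_diff1 fin inW)
    with rest \<open>?c0 = 0\<close> c(1) have "x \<in> convex hull ?R"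
      by (auto simp: convex_hull_finite fin)
    then show ?thesis ..
  qed
qed

theorem theorem4p3:
  fixes n :: nat
    and V T :: "(real ^ ('n::{finite,linorder})) set"
    and e :: "real ^ ('n::{finite,linorder})"
  assumes "n \<ge> 2" and "CARD('n) = n"
    and "V = perm_point ` sort_iterates (tau n)"
    and "T = convex hull V"
    and "e = perm_point (ident n)"
  shows "(int n - 1) simplex T
    \<and> hollow T
    \<and> convex hull (V - {e}) facet_of T
    \<and> (\<forall>x \<in> T \<inter> integer_points. \<not> x extreme_point_of T \<longrightarrow> x \<in> convex hull (V - {e}))"
proof -
  have V: "V = tau_vertex ` {..<CARD('n)}"
    using assms(1,2,3) by (auto simp: sort_iterates_tau tau_vertex_def)
  have e: "e = tau_vertex 0"
    using assms(1,2,5) by (simp add: tau_vertex_def tau_iterate_0)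
  have indep: "\<not> affine_dependent V"
    unfolding V by (rule affine_independent_tau_vertices)
  have card: "card V = n"
    unfolding V card_image[OF inj_on_tau_vertex] using assms(2) by simp
  have eV: "e \<in> V" unfolding V e by auto
  have simplex: "(int n - 1) simplex T"
    unfolding simplex assms(4) using indep card by (intro exI[of _ V]) (simp add: V)
  have "card (V - {e}) = n - 1" using card eV by simp
  with assms(1) have "V - {e} \<noteq> {}" by (intro notI) simp
  then have facet: "convex hull (V - {e}) facet_of T"
    unfolding assms(4) facet_of_convex_hull_affine_independent[OF indep] using eV by auto
  have extr: "x extreme_point_of T \<longleftrightarrow> x \<in> V" for x
    unfolding assms(4) by (rule extreme_point_of_convex_hull_affine_independent[OF indep])
  have dichotomy: "x = e \<or> x \<in> convex hull (V - {e})" if "x \<in> T \<inter> integer_points" for x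
    using integer_point_in_tau_hull[of x] that unfolding V e assms(4) by auto
  have "hollow T"
    unfolding hollow_def
  proof
    fix x assume "x \<in> T \<inter> integer_points"
    then consider "x = e" | "x \<in> convex hull (V - {e})" using dichotomy by blast
    then show "x \<in> rel_frontier T"
    proof cases
      case 1
      \<comment> \<open>A vertex is a proper face because the simplex has at least two of them.\<close>
      have "{e} face_of T" using extr eV by (simp add: face_of_singleton)
      moreover have "{e} \<noteq> T"
        using \<open>V - {e} \<noteq> {}\<close> hull_subset[of V convex] unfolding assms(4) by blast
      ultimately show ?thesis using 1 face_of_subset_rel_frontier by blast
    next
      case 2
      with facet show ?thesis
        using face_of_subset_rel_frontier facet_of_imp_face_of facet_of_irrefl by blast
    qed
  qed
  moreover have "x \<in> convex hull (V - {e})"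
    if "x \<in> T \<inter> integer_points" "\<not> x extreme_point_of T" for x
    using dichotomy[OF that(1)] that(2) eV extr by blast
  ultimately show ?thesis using simplex facet by blast
qed

end
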